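(* Let $X$ be a non-negative absolutely continuous random variable with cumulative distribution function $F$ and finite mean $\mathbb{E}(X)$, and suppose that $\lim_{x\to+\infty} -x(1-F(x))\log(1-F(x))=0$. Then the cumulative residual entropy of $X$ satisfies $$\mathcal{E}(X)=\sum_{n=1}^{+\infty}\frac{1}{n(n+1)}\,\mu_{n+1:n+1}-\mathbb{E}(X),$$ where $\mu_{n+1:n+1}$ is the mean of the largest order statistic in a sample of size $n+1$ from $F$.
   Context: $\log$ is the natural logarithm, with the convention $0\log 0=0$. The cumulative residual entropy of a non-negative absolutely continuous random variable $X$ with cumulative distribution function $F$ is $\mathcal{E}(X)=-\int_0^{+\infty}(1-F(x))\log(1-F(x))\,dx$. For i.i.d. random variables $X_1,\dots,X_m$ with the distribution of $X$, $X_{k:m}$ denotes the $k$-th smallest value (the $k$-th order statistic), and $\mu_{k:m}=\mathbb{E}(X_{k:m})$; in particular $\mu_{m:m}=\mathbb{E}(\max(X_1,\dots,X_m))$. *)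

theory Defs
  imports "HOL-Probability.Probability"
begin

text \<open>
  The integrand \<open>-(1 - F) log (1 - F)\<close> is nonnegative, since \<open>0 \<le> F \<le> 1\<close>, so
  the integral always exists in \<open>[0, \<infinity>]\<close>. It can be infinite even if the mean is finite
  and \<open>-x (1 - F x) log (1 - F x)\<close> tends to \<open>0\<close> (tail \<open>1 - F x\<close> of order
  \<open>1 / (x (log x)^2)\<close>), hence the extended real value. As \<open>ln 0 = 0\<close> in HOL, the
  convention \<open>0 log 0 = 0\<close> holds.
\<close>

definition cumulative_residual_entropy :: "'a measure \<Rightarrow> ('a \<Rightarrow> real) \<Rightarrow> ereal" where
  "cumulative_residual_entropy M X =
     (let F = cdf (distr M borel X) in
      enn2ereal (\<integral>\<^sup>+x\<in>{0..}. ennreal (- ((1 - F x) * ln (1 - F x))) \<partial>lborel))"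

text \<open>
  An i.i.d. sample \<open>Y 1, \<dots>, Y m\<close> with law \<open>D\<close>, on an arbitrary probability
  space \<open>N\<close>. Measurability of the \<open>Y i\<close> is part of \<open>indep_vars\<close>.
\<close>

definition iid_sample :: "'b measure \<Rightarrow> (nat \<Rightarrow> 'b \<Rightarrow> real) \<Rightarrow> nat \<Rightarrow> real measure \<Rightarrow> bool" where
  "iid_sample N Y m D \<longleftrightarrow>
     prob_space N \<and>
     prob_space.indep_vars N (\<lambda>_. borel) Y {1..m} \<and>
     (\<forall>i\<in>{1..m}. distr N borel (Y i) = D)"

text \<open>The \<open>k\<close>-th smallest of \<open>y 1, \<dots>, y m\<close>, meaningful for \<open>1 \<le> k \<le> m\<close>.\<close>

definition order_statistic :: "nat \<Rightarrow> nat \<Rightarrow> (nat \<Rightarrow> real) \<Rightarrow> real" where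
  "order_statistic k m y = sort (map y [1..<Suc m]) ! (k - 1)"

definition mean_order_statistic ::
  "'b measure \<Rightarrow> (nat \<Rightarrow> 'b \<Rightarrow> real) \<Rightarrow> nat \<Rightarrow> nat \<Rightarrow> real" where
  "mean_order_statistic N Y k m = (\<integral>\<omega>. order_statistic k m (\<lambda>i. Y i \<omega>) \<partial>N)"

end

theory Submission
  imports Defs
begin

text \<open>
  For a nonnegative random variable the mean is the area above its distribution function, and the
  largest of \<open>m\<close> independent copies has distribution function \<open>F ^ m\<close>. Hence
  \<open>\<mu>\<^bsub>m:m\<^esub>\<close> is the integral of \<open>1 - F ^ m\<close> over \<open>[0, \<infinity>)\<close>
  (\<open>mean_maximum_iid\<close>). Write \<open>S = 1 - F\<close>. Combining the logarithmic series for
  \<open>ln (1 - F)\<close> with the telescoping sum of \<open>1 / (n (n + 1))\<close> gives the pointwise identity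
  (\<open>sums_weighted_power_tails\<close>)
  that the sum over \<open>n \<ge> 1\<close> of \<open>(1 - F ^ (n + 1)) / (n (n + 1))\<close> is
  \<open>S - S ln S\<close>.

  All terms are nonnegative, so integration may be carried out term by term, whether or not
  the entropy is finite. The integral of \<open>S\<close> is the mean of \<open>X\<close>, that of
  \<open>- S ln S\<close> is the entropy, and the finite mean can be subtracted in the extended reals.
\<close>

text \<open>
  By \<open>1 / (n (n + 1)) = 1 / n - 1 / (n + 1)\<close> the part with \<open>t\<close> is a difference of two
  copies of the series of \<open>- ln (1 - t)\<close>, one multiplied by \<open>t\<close> and one shifted by an index.
  That series diverges at \<open>t = 1\<close>, but there every term of the sum vanishes.
\<close>

lemma sums_weighted_power_tails:
  fixes t :: real
  assumes "0 \<le> t" "t \<le> 1"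
  shows "(\<lambda>j. 1 / (real (Suc j) * real (Suc j + 1)) * (1 - t ^ (Suc j + 1)))
    sums ((1 - t) + - ((1 - t) * ln (1 - t)))"
proof -
  have "(\<lambda>j. 1 / real (Suc j) - 1 / real (Suc (Suc j))) sums (1 / real (Suc 0) - 0)"
    by (intro telescope_sums' LIMSEQ_Suc lim_1_over_n)
  then have tele: "(\<lambda>j. 1 / (real (Suc j) * real (Suc j + 1))) sums 1"
    by (simp add: field_simps)
  show ?thesis
  proof (cases "t = 1")
    case True
    then show ?thesis by simp
  next
    case False
    with assms have "(\<lambda>n. - ((- (- t)) ^ n) / real n) sums ln (1 + - t)"
      by (intro ln_series') auto
    from sums_minus[OF this] have log0: "(\<lambda>n. t ^ n / real n) sums (- ln (1 - t))"
      by simp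
    have log1: "(\<lambda>j. t ^ Suc j / real (Suc j)) sums (- ln (1 - t))"
      using log0 by (subst sums_Suc_iff) simp
    have log2: "(\<lambda>j. t ^ Suc (Suc j) / real (Suc (Suc j))) sums (- ln (1 - t) - t)"
      using log1 by (subst sums_Suc_iff) simp
    have "(\<lambda>j. 1 / (real (Suc j) * real (Suc j + 1))
        - (t * (t ^ Suc j / real (Suc j)) - t ^ Suc (Suc j) / real (Suc (Suc j))))
      sums (1 - (t * (- ln (1 - t)) - (- ln (1 - t) - t)))"
      by (intro sums_diff sums_mult tele log1 log2)
    also have "(\<lambda>j. 1 / (real (Suc j) * real (Suc j + 1))
        - (t * (t ^ Suc j / real (Suc j)) - t ^ Suc (Suc j) / real (Suc (Suc j)))) =
      (\<lambda>j. 1 / (real (Suc j) * real (Suc j + 1)) * (1 - t ^ (Suc j + 1)))"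
      by (intro ext) (simp add: divide_simps, simp add: algebra_simps)
    also have "1 - (t * (- ln (1 - t)) - (- ln (1 - t) - t)) = (1 - t) + - ((1 - t) * ln (1 - t))"
      by (simp add: algebra_simps)
    finally show ?thesis .
  qed
qed

text \<open>
  This single equivalence yields both the measurability of the maximum and, by independence, its
  distribution function.
\<close>

lemma order_statistic_max_le_iff:
  assumes "1 \<le> m"
  shows "order_statistic m m y \<le> a \<longleftrightarrow> (\<forall>i\<in>{1..m}. y i \<le> a)"
proof -
  let ?l = "sort (map y [1..<Suc m])"
  have len: "length ?l = m" by simp
  have set: "set ?l = y ` {1..m}" by (simp add: atLeastLessThanSuc_atLeastAtMost del: upt_Suc)
  have "?l ! (m - 1) \<in> set ?l" using assms len by (intro nth_mem) linarith
  moreover have "v \<le> ?l ! (m - 1)" if "v \<in> set ?l" for v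
  proof -
    from that obtain i where "i < m" "v = ?l ! i"
      by (metis in_set_conv_nth len)
    then show ?thesis using len by (auto intro!: sorted_nth_mono)
  qed
  ultimately have "?l ! (m - 1) \<le> a \<longleftrightarrow> (\<forall>v\<in>set ?l. v \<le> a)"
    by (meson order_trans)
  then show ?thesis unfolding order_statistic_def set by simp
qed

text \<open>
  A nonnegative number \<open>z\<close> is the length of \<open>{0..<z}\<close>; exchanging the order of
  integration turns its average into the integral of \<open>P (Z > x)\<close>.
\<close>

lemma nn_integral_eq_survival:
  fixes Z :: "'c \<Rightarrow> real"
  assumes "prob_space M" and Z[measurable]: "Z \<in> borel_measurable M"
    and nonneg: "AE \<omega> in M. 0 \<le> Z \<omega>"
  shows "(\<integral>\<^sup>+\<omega>. ennreal (Z \<omega>) \<partial>M) =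
    (\<integral>\<^sup>+x\<in>{0..}. ennreal (1 - cdf (distr M borel Z) x) \<partial>lborel)"
proof -
  interpret prob_space M by fact
  interpret P: pair_sigma_finite lborel M ..
  let ?h = "\<lambda>x \<omega>. indicator {w. 0 \<le> fst w \<and> fst w < Z (snd w)} (x, \<omega>) :: ennreal"
  have len: "(\<integral>\<^sup>+x. ?h x \<omega> \<partial>lborel) = ennreal (Z \<omega>)" if "0 \<le> Z \<omega>" for \<omega>
  proof -
    have "(\<integral>\<^sup>+x. ?h x \<omega> \<partial>lborel) = (\<integral>\<^sup>+x. indicator {0..<Z \<omega>} x \<partial>lborel)"
      by (intro nn_integral_cong) (auto simp: indicator_def)
    then show ?thesis using that by simp
  qed
  have surv: "(\<integral>\<^sup>+\<omega>. ?h x \<omega> \<partial>M) = ennreal (1 - cdf (distr M borel Z) x) * indicator {0..} x" for x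
  proof (cases "0 \<le> x")
    case True
    have "(\<integral>\<^sup>+\<omega>. ?h x \<omega> \<partial>M) = (\<integral>\<^sup>+\<omega>. indicator (space M - {\<omega>\<in>space M. Z \<omega> \<le> x}) \<omega> \<partial>M)"
      using True by (intro nn_integral_cong) (auto simp: indicator_def)
    also have "\<dots> = emeasure M (space M - {\<omega>\<in>space M. Z \<omega> \<le> x})"
      by (intro nn_integral_indicator) measurable
    also have "\<dots> = ennreal (1 - prob {\<omega>\<in>space M. Z \<omega> \<le> x})"
      by (simp add: emeasure_eq_measure prob_compl)
    also have "prob {\<omega>\<in>space M. Z \<omega> \<le> x} = cdf (distr M borel Z) x"
      by (auto simp: cdf_def measure_distr intro!: arg_cong[where f = prob])
    finally show ?thesis using True by simp
  next
    case False
    then show ?thesis by simp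
  qed
  have "(\<integral>\<^sup>+\<omega>. ennreal (Z \<omega>) \<partial>M) = (\<integral>\<^sup>+\<omega>. (\<integral>\<^sup>+x. ?h x \<omega> \<partial>lborel) \<partial>M)"
    using nonneg by (intro nn_integral_cong_AE) (auto simp: len)
  also have "\<dots> = (\<integral>\<^sup>+x. (\<integral>\<^sup>+\<omega>. ?h x \<omega> \<partial>M) \<partial>lborel)"
    by (rule P.Fubini') measurable
  finally show ?thesis by (simp add: surv)
qed

text \<open>
  The finite mean of \<open>D\<close> is what makes the Bochner integral defining the mean of the maximum
  genuine: by Bernoulli's inequality \<open>1 - F ^ m \<le> m (1 - F)\<close>. Otherwise that integral would take
  the default value \<open>0\<close>.
\<close>

lemma mean_maximum_iid:
  assumes iid: "iid_sample N Y m D" and m: "1 \<le> m"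
    and nonneg: "AE x in D. 0 \<le> x"
    and fin: "(\<integral>\<^sup>+x\<in>{0..}. ennreal (1 - cdf D x) \<partial>lborel) < \<infinity>"
  shows "0 \<le> mean_order_statistic N Y m m"
    and "ennreal (mean_order_statistic N Y m m) =
      (\<integral>\<^sup>+x\<in>{0..}. ennreal (1 - cdf D x ^ m) \<partial>lborel)"
proof -
  from iid interpret prob_space N by (simp add: iid_sample_def)
  have ind: "indep_vars (\<lambda>_. borel) Y {1..m}"
    and law: "\<And>i. i \<in> {1..m} \<Longrightarrow> distr N borel (Y i) = D"
    using iid by (auto simp: iid_sample_def)
  have meas: "Y i \<in> borel_measurable N" if "i \<in> {1..m}" for i
    using ind that by (auto simp: indep_vars_def)
  have one: "1 \<in> {1..m}" using m by simp
  interpret D: real_distribution D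
    using law[OF one] meas[OF one] by (metis real_distribution_distr)
  have [measurable]: "cdf D \<in> borel_measurable borel"
    by (intro borel_measurable_mono monoI D.cdf_nondecreasing)
  define Z where "Z \<omega> = order_statistic m m (\<lambda>i. Y i \<omega>)" for \<omega>
  have Z_le: "Z \<omega> \<le> a \<longleftrightarrow> (\<forall>i\<in>{1..m}. Y i \<omega> \<le> a)" for \<omega> a
    unfolding Z_def by (rule order_statistic_max_le_iff[OF m])
  have Z_vimage: "{\<omega>\<in>space N. Z \<omega> \<le> a} = (\<Inter>i\<in>{1..m}. Y i -` {..a} \<inter> space N)" for a
    using one by (auto simp: Z_le)
  have Z[measurable]: "Z \<in> borel_measurable N"
    unfolding borel_measurable_iff_le Z_vimage
  proof (intro allI sets.finite_INT)
    show "{1..m} \<noteq> {}" using one by blast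
  qed (auto intro: measurable_sets[OF meas])
  have "AE \<omega> in N. 0 \<le> Y 1 \<omega>"
    using nonneg by (intro AE_distrD[OF meas[OF one]]) (simp only: law[OF one])
  then have Z_nonneg: "AE \<omega> in N. 0 \<le> Z \<omega>"
  proof eventually_elim
    case (elim \<omega>)
    have "Y 1 \<omega> \<le> Z \<omega>" using Z_le[of \<omega> "Z \<omega>"] one by blast
    with elim show ?case by linarith
  qed
  have cdf_Z: "cdf (distr N borel Z) x = cdf D x ^ m" for x
  proof -
    have "cdf (distr N borel Z) x = prob {\<omega>\<in>space N. Z \<omega> \<le> x}"
      by (auto simp: cdf_def measure_distr intro!: arg_cong[where f = prob])
    also have "\<dots> = (\<Prod>i\<in>{1..m}. prob (Y i -` {..x} \<inter> space N))"
      unfolding Z_vimage using one by (intro indep_varsD_finite[OF ind]) auto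
    also have "\<dots> = (\<Prod>i\<in>{1..m}. cdf D x)"
    proof (intro prod.cong refl)
      fix i assume i: "i \<in> {1..m}"
      show "prob (Y i -` {..x} \<inter> space N) = cdf D x"
        unfolding law[OF i, symmetric] using meas[OF i] by (simp add: cdf_def measure_distr)
    qed
    finally show ?thesis by simp
  qed
  have eq: "(\<integral>\<^sup>+\<omega>. ennreal (Z \<omega>) \<partial>N) = (\<integral>\<^sup>+x\<in>{0..}. ennreal (1 - cdf D x ^ m) \<partial>lborel)"
    unfolding nn_integral_eq_survival[OF prob_space_axioms Z Z_nonneg] cdf_Z ..
  have bernoulli: "1 - cdf D x ^ m \<le> real m * (1 - cdf D x)" for x
    using Bernoulli_inequality[of "cdf D x - 1" m] D.cdf_nonneg[of x] by (simp add: algebra_simps)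
  have "(\<integral>\<^sup>+x\<in>{0..}. ennreal (1 - cdf D x ^ m) \<partial>lborel)
      \<le> (\<integral>\<^sup>+x. ennreal (real m) * (ennreal (1 - cdf D x) * indicator {0..} x) \<partial>lborel)"
    by (intro nn_integral_mono)
       (auto simp: indicator_def D.cdf_bounded_prob bernoulli simp flip: ennreal_mult)
  also have "\<dots> = ennreal (real m) * (\<integral>\<^sup>+x\<in>{0..}. ennreal (1 - cdf D x) \<partial>lborel)"
    by (intro nn_integral_cmult) measurable
  also have "\<dots> < \<infinity>" using fin by (simp add: ennreal_mult_less_top)
  finally have "(\<integral>\<^sup>+\<omega>. ennreal (Z \<omega>) \<partial>N) < \<infinity>" unfolding eq .
  then have int: "integrable N Z" by (intro integrableI_nonneg Z Z_nonneg)
  have mean: "mean_order_statistic N Y m m = integral\<^sup>L N Z"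
    by (simp add: mean_order_statistic_def Z_def[abs_def])
  show "0 \<le> mean_order_statistic N Y m m"
    unfolding mean using Z_nonneg by (rule integral_nonneg_AE)
  show "ennreal (mean_order_statistic N Y m m) =
      (\<integral>\<^sup>+x\<in>{0..}. ennreal (1 - cdf D x ^ m) \<partial>lborel)"
    unfolding mean eq[symmetric] using nn_integral_eq_integral[OF int Z_nonneg] by simp
qed

theorem mainTheorem1:
  fixes M :: "'a measure" and X :: "'a \<Rightarrow> real" and F :: "real \<Rightarrow> real"
    and N :: "nat \<Rightarrow> 'b measure" and Y :: "nat \<Rightarrow> nat \<Rightarrow> 'b \<Rightarrow> real"
  defines "F \<equiv> cdf (distr M borel X)"
  assumes "prob_space M"
    and "X \<in> borel_measurable M"
    and "AE \<omega> in M. 0 \<le> X \<omega>"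
    and "absolutely_continuous lborel (distr M borel X)"
    and "integrable M X"
    and "((\<lambda>x. - x * (1 - F x) * ln (1 - F x)) \<longlongrightarrow> 0) at_top"
    and "\<And>m. 1 \<le> m \<Longrightarrow> iid_sample (N m) (Y m) m (distr M borel X)"
  shows "cumulative_residual_entropy M X =
    (\<Sum>j. let n = Suc j in
       ereal (1 / (real n * real (n + 1)) *
              mean_order_statistic (N (n + 1)) (Y (n + 1)) (n + 1) (n + 1)))
    - ereal (\<integral>\<omega>. X \<omega> \<partial>M)"
proof -
  interpret M: prob_space M by fact
  note X = \<open>X \<in> borel_measurable M\<close>
  let ?D = "distr M borel X"
  interpret D: real_distribution ?D using X by (rule M.real_distribution_distr)
  have F_bounds: "0 \<le> F x" "F x \<le> 1" for x
    unfolding F_def by (rule D.cdf_nonneg, rule D.cdf_bounded_prob)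
  have F_meas[measurable]: "F \<in> borel_measurable borel"
    unfolding F_def by (intro borel_measurable_mono monoI D.cdf_nondecreasing)
  let ?c = "\<lambda>j. 1 / (real (Suc j) * real (Suc j + 1))"
  let ?\<mu> = "\<lambda>j. mean_order_statistic (N (Suc j + 1)) (Y (Suc j + 1)) (Suc j + 1) (Suc j + 1)"
  let ?H = "\<integral>\<^sup>+x\<in>{0..}. ennreal (- ((1 - F x) * ln (1 - F x))) \<partial>lborel"
  have mean: "(\<integral>\<^sup>+x\<in>{0..}. ennreal (1 - F x) \<partial>lborel) = ennreal (\<integral>\<omega>. X \<omega> \<partial>M)"
    unfolding F_def nn_integral_eq_survival[OF \<open>prob_space M\<close> X \<open>AE \<omega> in M. 0 \<le> X \<omega>\<close>, symmetric]
    by (rule nn_integral_eq_integral) fact+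
  have mean_nonneg: "0 \<le> (\<integral>\<omega>. X \<omega> \<partial>M)"
    by (rule integral_nonneg_AE) fact
  have D_nonneg: "AE x in ?D. 0 \<le> x"
    using \<open>AE \<omega> in M. 0 \<le> X \<omega>\<close> X by (subst AE_distr_iff) auto
  have fin: "(\<integral>\<^sup>+x\<in>{0..}. ennreal (1 - cdf ?D x) \<partial>lborel) < \<infinity>"
    using mean unfolding F_def by simp
  have iid: "iid_sample (N (Suc j + 1)) (Y (Suc j + 1)) (Suc j + 1) ?D" for j
    by (rule assms) simp
  have \<mu>_nonneg: "0 \<le> ?\<mu> j" for j
    by (rule mean_maximum_iid(1)[OF iid _ D_nonneg fin]) simp
  have \<mu>: "ennreal (?\<mu> j) = (\<integral>\<^sup>+x\<in>{0..}. ennreal (1 - F x ^ (Suc j + 1)) \<partial>lborel)" for j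
    unfolding F_def by (rule mean_maximum_iid(2)[OF iid _ D_nonneg fin]) simp
  have entropy_nonneg: "0 \<le> - ((1 - F x) * ln (1 - F x))" for x
  proof -
    have "ln (1 - F x) \<le> 0" using F_bounds[of x] by (cases "F x = 1") auto
    then show ?thesis using F_bounds[of x] by (simp add: mult_nonneg_nonpos)
  qed
  have pointwise: "(\<Sum>j. ennreal (?c j * (1 - F x ^ (Suc j + 1)))) =
      ennreal (1 - F x) + ennreal (- ((1 - F x) * ln (1 - F x)))" for x
  proof -
    have nn: "0 \<le> ?c j * (1 - F x ^ (Suc j + 1))" for j
      using F_bounds[of x] by (intro mult_nonneg_nonneg) (auto simp: power_le_one simp del: power_Suc)
    note s = sums_weighted_power_tails[OF F_bounds[of x]]
    show ?thesis
      using suminf_ennreal_eq[OF nn s] F_bounds[of x] entropy_nonneg[of x]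
      by (simp only: ennreal_plus diff_ge_0_iff_ge)
  qed
  have "(\<Sum>j. ennreal (?c j * ?\<mu> j)) =
      (\<Sum>j. \<integral>\<^sup>+x. ennreal (?c j * (1 - F x ^ (Suc j + 1))) * indicator {0..} x \<partial>lborel)"
  proof (intro arg_cong[where f = suminf] ext)
    fix j
    have "ennreal (?c j * ?\<mu> j) =
        ennreal (?c j) * (\<integral>\<^sup>+x\<in>{0..}. ennreal (1 - F x ^ (Suc j + 1)) \<partial>lborel)"
      unfolding \<mu>[symmetric] by (intro ennreal_mult \<mu>_nonneg) simp
    also have "\<dots> =
        (\<integral>\<^sup>+x. ennreal (?c j) * (ennreal (1 - F x ^ (Suc j + 1)) * indicator {0..} x) \<partial>lborel)"
      by (intro nn_integral_cmult[symmetric]) measurable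
    also have "\<dots> = (\<integral>\<^sup>+x. ennreal (?c j * (1 - F x ^ (Suc j + 1))) * indicator {0..} x \<partial>lborel)"
    proof (intro nn_integral_cong)
      fix x
      have "0 \<le> 1 - F x ^ (Suc j + 1)"
        using F_bounds[of x] by (simp add: power_le_one del: power_Suc)
      moreover have "0 \<le> ?c j" by simp
      ultimately show "ennreal (?c j) * (ennreal (1 - F x ^ (Suc j + 1)) * indicator {0..} x) =
          ennreal (?c j * (1 - F x ^ (Suc j + 1))) * indicator {0..} x"
        by (metis ennreal_mult mult.assoc)
    qed
    finally show "ennreal (?c j * ?\<mu> j) = \<dots>" .
  qed
  also have "\<dots> = (\<integral>\<^sup>+x. (\<Sum>j. ennreal (?c j * (1 - F x ^ (Suc j + 1))) * indicator {0..} x) \<partial>lborel)"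
    by (intro nn_integral_suminf[symmetric]) measurable
  also have "\<dots> = (\<integral>\<^sup>+x. ennreal (1 - F x) * indicator {0..} x
      + ennreal (- ((1 - F x) * ln (1 - F x))) * indicator {0..} x \<partial>lborel)"
    by (simp only: ennreal_suminf_multc pointwise distrib_right)
  also have "\<dots> = (\<integral>\<^sup>+x\<in>{0..}. ennreal (1 - F x) \<partial>lborel) + ?H"
    by (intro nn_integral_add) measurable
  also have "\<dots> = ennreal (\<integral>\<omega>. X \<omega> \<partial>M) + ?H"
    by (simp only: mean)
  finally have total: "(\<Sum>j. ennreal (?c j * ?\<mu> j)) = ennreal (\<integral>\<omega>. X \<omega> \<partial>M) + ?H" .
  (* All terms are nonnegative, so the series in the extended reals is the image of this one. *)
  have "(\<Sum>j. ereal (?c j * ?\<mu> j)) = (\<Sum>j. enn2ereal (ennreal (?c j * ?\<mu> j)))"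
    using \<mu>_nonneg by (intro arg_cong[where f = suminf] ext) (simp add: enn2ereal_ennreal)
  also have "\<dots> = ereal (\<integral>\<omega>. X \<omega> \<partial>M) + enn2ereal ?H"
    unfolding suminf_enn2ereal total plus_ennreal.rep_eq using mean_nonneg by simp
  finally have "(\<Sum>j. ereal (?c j * ?\<mu> j)) - ereal (\<integral>\<omega>. X \<omega> \<partial>M) = enn2ereal ?H"
    by (cases "enn2ereal ?H") auto
  then show ?thesis
    by (simp only: cumulative_residual_entropy_def Let_def F_def)
qed

end
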